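(* Let $d,k$ be integers with $1\le k\le d$, and let $p_{d+k,d}$ denote the number of $d$-minimal permutations of length $d+k$. Then $$p_{d+k,d}=\sum_{\substack{a_1,a_2,\ldots,a_k\ge 2\\ a_1+a_2+\cdots+a_k=d+k}}(d+k)!\cdot\det\big(A(a_1,\ldots,a_k)\big),$$ where the sum is over $k$-tuples of integers and $A(a_1,\ldots,a_k)$ is the $k\times k$ matrix with entries $a_{i,j}$ ($1\le i,j\le k$) given by $$a_{i,j}=\frac{1}{(a_i+\cdots+a_j+i-j)!}\ \text{ when } i\le j,\qquad a_{i,i-1}=1,\qquad a_{i,i-2}=\chi_{a_{i-1}=2},\qquad a_{i,j}=0\ \text{ when } i>j+2.$$
   Context: A descent of a permutation $\sigma=\sigma(1)\cdots\sigma(n)$ of $\{1,\dots,n\}$ is an index $i\in\{1,\dots,n-1\}$ with $\sigma(i)>\sigma(i+1)$. A permutation $\sigma$ of length $n$ is $d$-minimal (a minimal permutation with $d$ descents) if it is minimal, for the pattern-involvement order, for the property of having $d$ descents; in other words, $\sigma$ has exactly $d$ descents and, whenever any one of its entries is removed and the remaining entries are renamed order-isomorphically to $1,\dots,n-1$, the resulting permutation has $d-1$ descents. For a property $P$, $\chi_P=1$ if $P$ is true and $\chi_P=0$ otherwise. *)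

theory Defs
  imports
    "HOL-Combinatorics.Multiset_Permutations"
    "HOL-Library.Sublist"
    "Jordan_Normal_Form.Determinant"
begin

text \<open>
  A permutation of \<open>{1..n}\<close> is given in one-line notation, as a list in the library set
  \<^const>\<open>permutations_of_set\<close> \<open>{1..n}\<close>.  List positions start at 0, so position \<open>i\<close> of the list
  holds the value at \<open>i + 1\<close>.
\<close>

definition is_perm :: "nat list \<Rightarrow> bool" where
  "is_perm s \<longleftrightarrow> s \<in> permutations_of_set {1..length s}"

definition descents :: "nat list \<Rightarrow> nat" where
  "descents s = card {i. Suc i < length s \<and> s ! i > s ! Suc i}"

definition order_isomorphic :: "nat list \<Rightarrow> nat list \<Rightarrow> bool" where
  "order_isomorphic s t \<longleftrightarrow> length s = length t \<and>
     (\<forall>i<length s. \<forall>j<length s. s ! i < s ! j \<longleftrightarrow> t ! i < t ! j)"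

definition involved :: "nat list \<Rightarrow> nat list \<Rightarrow> bool" where
  "involved p s \<longleftrightarrow> (\<exists>t. subseq t s \<and> order_isomorphic p t)"

definition minimal_perm :: "nat \<Rightarrow> nat list \<Rightarrow> bool" where
  "minimal_perm d s \<longleftrightarrow> is_perm s \<and> descents s = d \<and>
     (\<forall>p. is_perm p \<and> involved p s \<and> p \<noteq> s \<longrightarrow> descents p \<noteq> d)"

definition num_minimal :: "nat \<Rightarrow> nat \<Rightarrow> nat" where
  "num_minimal n d = card {s \<in> permutations_of_set {1..n}. minimal_perm d s}"

text \<open>
  Rows, columns and tuple entries are numbered from 0; only differences of indices enter the
  formulas.  In the entry with \<open>i = j + 2\<close>, the relevant tuple entry is the one at \<open>i - 1\<close>.
  The subtraction on \<^typ>\<open>nat\<close> in the factorial does not truncate when all entries of \<open>a\<close> are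
  at least 1.
\<close>

definition A_mat :: "nat list \<Rightarrow> real mat" where
  "A_mat a = mat (length a) (length a) (\<lambda>(i, j).
     if i \<le> j then 1 / fact ((\<Sum>l=i..j. a ! l) + i - j)
     else if i = j + 1 then 1
     else if i = j + 2 then of_bool (a ! (i - 1) = 2)
     else 0)"

text \<open>
  The rest of the theory shows that \<^const>\<open>minimal_perm\<close> can be tested by removing one entry at a
  time and renaming the remaining ones.
\<close>

definition remove_at :: "nat \<Rightarrow> 'a list \<Rightarrow> 'a list" where
  "remove_at i s = take i s @ drop (Suc i) s"

definition standardize :: "nat list \<Rightarrow> nat list" where
  "standardize s = map (\<lambda>x. card {y \<in> set s. y \<le> x}) s"

lemma descents_Nil [simp]: "descents [] = 0"
  and descents_single [simp]: "descents [x] = 0"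
  by (auto simp: descents_def)

lemma descents_Cons_Cons [simp]:
  "descents (x # y # s) = of_bool (x > y) + descents (y # s)"
proof -
  let ?D = "{i. Suc i < length (y # s) \<and> (y # s) ! i > (y # s) ! Suc i}"
  have eq: "{i. Suc i < length (x # y # s) \<and> (x # y # s) ! i > (x # y # s) ! Suc i} =
      (if x > y then {0} else {}) \<union> Suc ` ?D" (is "?L = ?R")
  proof (rule Set.set_eqI)
    fix i show "i \<in> ?L \<longleftrightarrow> i \<in> ?R" by (cases i) auto
  qed
  have "finite ?D" by (rule finite_subset[of _ "{..length (y # s)}"]) auto
  then have "card ?R = of_bool (x > y) + card ?D"
    by (auto simp: card_image card_insert_if)
  then show ?thesis unfolding descents_def eq .
qed

lemma descents_remove1:
  "descents (u @ v) \<le> descents (u @ x # v) \<and> descents (u @ x # v) \<le> descents (u @ v) + 1"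
proof (induction u rule: induct_list012)
  case 1 then show ?case by (cases v) auto
next
  case (2 w) then show ?case by (cases v) auto
next
  case (3 w z u) then show ?case by simp
qed

lemma proper_subseqD:
  assumes "subseq t s" "t \<noteq> s"
  shows "\<exists>u x v. s = u @ x # v \<and> subseq t (u @ v)"
  using assms
proof (induction rule: list_emb.induct)
  case (list_emb_Nil s)
  then show ?case by (cases s) (auto intro: exI[of _ "[]"])
next
  case (list_emb_Cons t s x)
  then show ?case by (intro exI[of _ "[]"]) auto
next
  case (list_emb_Cons2 x y t s)
  then obtain u z v where "s = u @ z # v" "subseq t (u @ v)" by auto
  with list_emb_Cons2 show ?case by (intro exI[of _ "y # u"]) auto
qed

lemma descents_subseq: "subseq t s \<Longrightarrow> descents t \<le> descents s"
proof (induction "length s" arbitrary: s rule: less_induct)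
  case less
  show ?case
  proof (cases "t = s")
    case False
    then obtain u x v where s: "s = u @ x # v" and "subseq t (u @ v)"
      using proper_subseqD less.prems by blast
    then have "descents t \<le> descents (u @ v)" using less.hyps by auto
    then show ?thesis using descents_remove1[of u v x] s by auto
  qed auto
qed

lemma descents_order_isomorphic: "order_isomorphic s t \<Longrightarrow> descents s = descents t"
  unfolding order_isomorphic_def descents_def by (intro arg_cong[where f = card]) auto

lemma rank_less:
  fixes S :: "nat set"
  assumes "finite S" "b \<in> S" "a < b"
  shows "card {y \<in> S. y \<le> a} < card {y \<in> S. y \<le> b}"
proof (rule psubset_card_mono)
  have "b \<in> {y \<in> S. y \<le> b}" "b \<notin> {y \<in> S. y \<le> a}" using assms by auto
  moreover have "{y \<in> S. y \<le> a} \<subseteq> {y \<in> S. y \<le> b}" using assms by auto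
  ultimately show "{y \<in> S. y \<le> a} \<subset> {y \<in> S. y \<le> b}" by blast
qed (use assms in simp)

lemma order_isomorphic_standardize: "order_isomorphic (standardize s) s"
proof -
  have "card {y \<in> set s. y \<le> a} < card {y \<in> set s. y \<le> b} \<longleftrightarrow> a < b"
    if "a \<in> set s" "b \<in> set s" for a b
  proof
    assume "a < b"
    then show "card {y \<in> set s. y \<le> a} < card {y \<in> set s. y \<le> b}"
      using that by (intro rank_less) auto
  next
    assume less: "card {y \<in> set s. y \<le> a} < card {y \<in> set s. y \<le> b}"
    show "a < b"
    proof (rule ccontr)
      assume "\<not> a < b"
      then have "card {y \<in> set s. y \<le> b} \<le> card {y \<in> set s. y \<le> a}"
        by (intro card_mono) auto
      with less show False by simp
    qed
  qed
  then show ?thesis unfolding order_isomorphic_def standardize_def by simp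
qed

lemma is_perm_standardize:
  assumes "distinct s"
  shows "is_perm (standardize s)"
proof -
  let ?f = "\<lambda>x. card {y \<in> set s. y \<le> x}"
  have mono: "?f a < ?f b" if "b \<in> set s" "a < b" for a b
    using that by (intro rank_less) auto
  have inj: "inj_on ?f (set s)"
  proof (rule inj_onI)
    fix a b assume "a \<in> set s" "b \<in> set s" "?f a = ?f b"
    then show "a = b" using mono[of a b] mono[of b a] by (cases a b rule: linorder_cases) auto
  qed
  have "?f ` set s \<subseteq> {1..length s}"
  proof
    fix z assume "z \<in> ?f ` set s"
    then obtain x where x: "x \<in> set s" and z: "z = ?f x" by auto
    have "?f x \<le> card (set s)" by (rule card_mono) auto
    moreover have "?f x > 0" using x by (auto simp: card_gt_0_iff)
    ultimately show "z \<in> {1..length s}" using z distinct_card[OF assms] by auto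
  qed
  moreover have "card (?f ` set s) = length s"
    using inj assms by (simp add: card_image distinct_card)
  ultimately have "?f ` set s = {1..length s}"
    by (simp add: card_subset_eq)
  then show ?thesis
    using inj assms
    by (simp add: is_perm_def standardize_def permutations_of_set_def distinct_map)
qed

lemma standardize_is_perm:
  assumes "is_perm s"
  shows "standardize s = s"
proof -
  have set: "set s = {1..length s}"
    using assms by (simp add: is_perm_def permutations_of_set_def)
  have "card {y \<in> set s. y \<le> x} = x" if "x \<in> set s" for x
  proof -
    have "{y \<in> set s. y \<le> x} = {1..x}" using that unfolding set by auto
    then show ?thesis by simp
  qed
  then show ?thesis unfolding standardize_def by (simp add: map_idI)
qed

lemma order_isomorphic_perm_eq:
  assumes iso: "order_isomorphic s t" and perms: "is_perm s" "is_perm t"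
  shows "s = t"
proof -
  have nth: "card {y \<in> set r. y \<le> r ! i} = card {j. j < length r \<and> \<not> r ! i < r ! j}"
    if "distinct r" for r :: "nat list" and i
  proof -
    have "{y \<in> set r. y \<le> r ! i} = (!) r ` {j. j < length r \<and> \<not> r ! i < r ! j}"
      by (auto simp: in_set_conv_nth not_less)
    moreover have "inj_on ((!) r) {j. j < length r \<and> \<not> r ! i < r ! j}"
      using that by (auto simp: inj_on_def nth_eq_iff_index_eq)
    ultimately show ?thesis by (simp add: card_image)
  qed
  have dist: "distinct s" "distinct t"
    using perms by (auto simp: is_perm_def permutations_of_set_def)
  have len: "length s = length t" using iso by (simp add: order_isomorphic_def)
  have "standardize s = standardize t"
  proof (rule nth_equalityI)
    fix i assume "i < length (standardize s)"
    then have i: "i < length s" by (simp add: standardize_def)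
    then have "{j. j < length s \<and> \<not> s ! i < s ! j} = {j. j < length t \<and> \<not> t ! i < t ! j}"
      using iso unfolding order_isomorphic_def by auto
    then show "standardize s ! i = standardize t ! i"
      using i len nth[OF dist(1), of i] nth[OF dist(2), of i] by (simp add: standardize_def)
  qed (simp add: standardize_def len)
  then show ?thesis using perms by (simp add: standardize_is_perm)
qed

theorem minimal_perm_iff_remove_at:
  assumes perm: "is_perm s"
  shows "minimal_perm d s \<longleftrightarrow> descents s = d \<and>
           (\<forall>i<length s. descents (standardize (remove_at i s)) + 1 = d)"
proof
  assume min: "minimal_perm d s"
  have "descents (standardize (remove_at i s)) + 1 = d" if i: "i < length s" for i
  proof -
    let ?t = "remove_at i s"
    have s: "s = take i s @ s ! i # drop (Suc i) s" using i by (rule id_take_nth_drop)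
    have sub: "subseq ?t s"
      unfolding remove_at_def by (subst (3) s) (auto intro: list_emb_append_mono)
    have "distinct s" using perm by (simp add: is_perm_def permutations_of_set_def)
    then have "distinct ?t"
      by (simp add: remove_at_def set_take_disj_set_drop_if_distinct)
    then have "is_perm (standardize ?t)" by (rule is_perm_standardize)
    moreover have "involved (standardize ?t) s"
      using sub order_isomorphic_standardize unfolding involved_def by blast
    moreover have "length (standardize ?t) \<noteq> length s"
      using i by (simp add: standardize_def remove_at_def)
    ultimately have "descents (standardize ?t) \<noteq> d"
      using min unfolding minimal_perm_def by auto
    moreover have "descents (standardize ?t) = descents ?t"
      by (rule descents_order_isomorphic[OF order_isomorphic_standardize])
    moreover have "descents ?t \<le> descents s \<and> descents s \<le> descents ?t + 1"
      using descents_remove1[of "take i s" "drop (Suc i) s" "s ! i"] s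
      by (simp add: remove_at_def)
    moreover have "descents s = d" using min by (simp add: minimal_perm_def)
    ultimately show ?thesis by linarith
  qed
  then show "descents s = d \<and> (\<forall>i<length s. descents (standardize (remove_at i s)) + 1 = d)"
    using min by (simp add: minimal_perm_def)
next
  assume rem: "descents s = d \<and> (\<forall>i<length s. descents (standardize (remove_at i s)) + 1 = d)"
  have "descents p \<noteq> d" if p: "is_perm p" "involved p s" "p \<noteq> s" for p
  proof -
    obtain t where sub: "subseq t s" and iso: "order_isomorphic p t"
      using p by (auto simp: involved_def)
    have "t \<noteq> s" using order_isomorphic_perm_eq iso p perm by blast
    then obtain u x v where s: "s = u @ x # v" and t: "subseq t (u @ v)"
      using proper_subseqD sub by blast
    have "remove_at (length u) s = u @ v" by (simp add: s remove_at_def)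
    moreover have "length u < length s" by (simp add: s)
    ultimately have "descents (standardize (u @ v)) + 1 = d" using rem by metis
    then have "descents (u @ v) + 1 = d"
      by (simp add: descents_order_isomorphic[OF order_isomorphic_standardize])
    then show ?thesis
      using descents_subseq[OF t] descents_order_isomorphic[OF iso] by simp
  qed
  then show "minimal_perm d s" using perm rem by (simp add: minimal_perm_def)
qed

end

theory Submission
  imports Defs
begin

text \<open>
  Cut a permutation into its maximal decreasing runs. Removing an entry changes the number of
  descents only through the two steps next to it, so minimality is a local condition on the steps:
  no two increasing steps are adjacent, none is first or last, and \<open>s(p) < s(p + 2)\<close> whenever one of
  the two steps between these positions is increasing (\<open>minimal_perm_iff_run_starts\<close>). Hence a
  minimal permutation of length \<open>d + k\<close> with \<open>d\<close> descents has \<open>k\<close> runs, of lengths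
  \<open>a\<^sub>1, \<dots>, a\<^sub>k \<ge> 2\<close>, and these lengths form the composition over which the sum ranges.

  Fix the lengths and write each run from right to left as one row of a diagram, so that rows
  increase from left to right. If the first two entries of each run are put below the last two of
  the preceding run, the conditions \<open>s(p) < s(p + 2)\<close> say exactly that columns increase downwards. So
  the permutations with these run lengths are the standard tableaux of a skew shape in which
  consecutive rows share two columns (\<open>covers_increasing_iff\<close>).

  The number of standard tableaux of skew shape \<open>\<nu>/\<mu>\<close> with \<open>n\<close> cells is, by a classical formula of
  Aitken, \<open>n! det (1 / (\<nu>\<^sub>i - \<mu>\<^sub>j - i + j)!)\<close>; for the shape above its entries are those of the matrix in
  the theorem (\<open>inverse_fact_det_eq_det_A_mat\<close>). The formula (\<open>card_skew_tableaux\<close>) follows by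
  induction on \<open>n\<close>. The largest entry of a tableau sits in a corner, so the number of tableaux is the
  sum of the numbers for the shapes with one corner removed. The determinants, as functions of the
  row ends \<open>\<nu>\<close>, satisfy the matching recurrence (\<open>sum_inverse_fact_det_pred\<close>), in which all rows are
  shortened, corner or not; shortening a row that does not end in a corner gives determinant zero.
\<close>

section \<open>Linear extensions\<close>

definition linear_extensions :: "'a set \<Rightarrow> ('a \<times> 'a) set \<Rightarrow> ('a \<Rightarrow> nat) set" where
  "linear_extensions C R = {f \<in> extensional C. bij_betw f C {1..card C} \<and>
     (\<forall>x\<in>C. \<forall>y\<in>C. (x, y) \<in> R \<longrightarrow> f x < f y)}"

lemma finite_linear_extensions:
  assumes "finite C"
  shows "finite (linear_extensions C R)"
proof (rule finite_subset)
  show "linear_extensions C R \<subseteq> C \<rightarrow>\<^sub>E {1..card C}"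
    by (auto simp: linear_extensions_def PiE_def dest: bij_betwE)
  show "finite (C \<rightarrow>\<^sub>E {1..card C})" using assms by (intro finite_PiE) auto
qed

lemma linear_extensions_empty [simp]: "linear_extensions {} R = {\<lambda>_. undefined}"
  by (auto simp: linear_extensions_def bij_betw_def)

text \<open>
  Deleting a maximal element that carries the largest label is undone by giving it that label
  again.
\<close>

lemma card_linear_extensions_at_max:
  assumes C: "finite C" "x \<in> C" and max: "\<forall>y\<in>C. (x, y) \<notin> R"
  shows "card {f \<in> linear_extensions C R. f x = card C} = card (linear_extensions (C - {x}) R)"
proof (rule bij_betw_same_card[of "\<lambda>f. restrict f (C - {x})"],
       rule bij_betw_byWitness[where f' = "\<lambda>g. g(x := card C)"])
  let ?n = "card C"
  have n: "card (C - {x}) = ?n - 1" "?n > 0" using C by (auto simp: card_gt_0_iff)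
  have ivl: "{1..?n - 1} = {1..?n} - {?n}" by auto
  show "\<forall>f\<in>{f \<in> linear_extensions C R. f x = ?n}. (restrict f (C - {x}))(x := ?n) = f"
    by (auto simp: linear_extensions_def extensional_def restrict_def fun_eq_iff)
  show "\<forall>g\<in>linear_extensions (C - {x}) R. restrict (g(x := ?n)) (C - {x}) = g"
    by (auto simp: linear_extensions_def extensional_def restrict_def fun_eq_iff)
  show "(\<lambda>f. restrict f (C - {x})) ` {f \<in> linear_extensions C R. f x = ?n}
      \<subseteq> linear_extensions (C - {x}) R"
  proof clarify
    fix f assume f: "f \<in> linear_extensions C R" "f x = ?n"
    then have "bij_betw f C {1..?n}" by (simp add: linear_extensions_def)
    then have "bij_betw f (C - {x}) ({1..?n} - {?n})"
      using C f(2) by (metis bij_betw_DiffI bij_betw_singletonI empty_subsetI insert_subset n(2)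
          atLeastAtMost_iff Suc_leI One_nat_def order_refl)
    then have "bij_betw f (C - {x}) {1..card (C - {x})}" by (simp only: n ivl)
    then show "restrict f (C - {x}) \<in> linear_extensions (C - {x}) R"
      using f bij_betw_cong[of "C - {x}" "restrict f (C - {x})" f]
      by (auto simp: linear_extensions_def)
  qed
  show "(\<lambda>g. g(x := ?n)) ` linear_extensions (C - {x}) R
      \<subseteq> {f \<in> linear_extensions C R. f x = ?n}"
  proof clarify
    fix g assume g: "g \<in> linear_extensions (C - {x}) R"
    then have bij: "bij_betw g (C - {x}) {1..?n - 1}" by (simp add: linear_extensions_def n)
    then have "bij_betw (g(x := ?n)) (C - {x}) {1..?n - 1}"
      using bij_betw_cong[of "C - {x}" "g(x := ?n)" g] by simp
    moreover have "bij_betw (g(x := ?n)) {x} {?n}" by (simp add: bij_betw_singletonI)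
    ultimately have "bij_betw (g(x := ?n)) ((C - {x}) \<union> {x}) ({1..?n - 1} \<union> {?n})"
      by (rule bij_betw_combine) (use n in auto)
    moreover have "(C - {x}) \<union> {x} = C" "{1..?n - 1} \<union> {?n} = {1..?n}" using C n by auto
    ultimately have "bij_betw (g(x := ?n)) C {1..?n}" by simp
    moreover have "g(x := ?n) \<in> extensional C"
      using g C by (auto simp: linear_extensions_def extensional_def)
    moreover have "(g(x := ?n)) y < (g(x := ?n)) z" if "y \<in> C" "z \<in> C" "(y, z) \<in> R" for y z
    proof -
      have "y \<noteq> x" using max that by auto
      then have "g y \<in> {1..?n - 1}" using bij that by (auto dest: bij_betwE)
      then show ?thesis using \<open>y \<noteq> x\<close> g that n by (auto simp: linear_extensions_def)
    qed
    ultimately show "g(x := ?n) \<in> linear_extensions C R \<and> (g(x := ?n)) x = ?n"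
      by (simp add: linear_extensions_def)
  qed
qed

text \<open>
  The element with the largest label can have nothing above it; classify the linear extensions by
  that element.
\<close>

lemma card_linear_extensions:
  assumes "finite C" "C \<noteq> {}"
  shows "card (linear_extensions C R) =
    (\<Sum>x | x \<in> C \<and> (\<forall>y\<in>C. (x, y) \<notin> R). card (linear_extensions (C - {x}) R))"
proof -
  let ?M = "{x \<in> C. \<forall>y\<in>C. (x, y) \<notin> R}"
  let ?L = "\<lambda>x. {f \<in> linear_extensions C R. f x = card C}"
  have pos: "card C > 0" using assms by (simp add: card_gt_0_iff)
  have "linear_extensions C R = (\<Union>x\<in>?M. ?L x)"
  proof
    show "linear_extensions C R \<subseteq> (\<Union>x\<in>?M. ?L x)"
    proof
      fix f assume f: "f \<in> linear_extensions C R"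
      then have bij: "bij_betw f C {1..card C}" by (simp add: linear_extensions_def)
      then have "card C \<in> f ` C" using pos by (simp add: bij_betw_imp_surj_on)
      then obtain x where x: "x \<in> C" "f x = card C" by force
      have "(x, y) \<notin> R" if "y \<in> C" for y
        using f x that bij_betwE[OF bij] unfolding linear_extensions_def
        by (metis (no_types, lifting) atLeastAtMost_iff linorder_not_less mem_Collect_eq)
      then show "f \<in> (\<Union>x\<in>?M. ?L x)" using x f by auto
    qed
  qed auto
  then have "card (linear_extensions C R) = card (\<Union>x\<in>?M. ?L x)" by simp
  also have "\<dots> = (\<Sum>x\<in>?M. card (?L x))"
  proof (rule card_UN_disjoint)
    show "finite ?M" using assms by simp
    show "\<forall>x\<in>?M. finite (?L x)" using finite_linear_extensions[OF assms(1)] by simp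
    show "\<forall>x\<in>?M. \<forall>y\<in>?M. x \<noteq> y \<longrightarrow> ?L x \<inter> ?L y = {}"
      by (auto simp: linear_extensions_def bij_betw_def inj_on_def)
  qed
  also have "\<dots> = (\<Sum>x\<in>?M. card (linear_extensions (C - {x}) R))"
    using assms by (intro sum.cong card_linear_extensions_at_max) auto
  finally show ?thesis .
qed

section \<open>Determinants of inverse factorials\<close>

text \<open>
  \<open>1 / \<Gamma>(z + 1)\<close> on the integers. The value 0 at negative integers makes the recurrence of the
  reciprocal factorial hold at every integer, with no boundary case at 0.
\<close>

definition inverse_fact :: "int \<Rightarrow> real" where
  "inverse_fact z = (if z < 0 then 0 else 1 / fact (nat z))"

lemma inverse_fact_pred: "inverse_fact (z - 1) = of_int z * inverse_fact z"
proof (cases "z \<ge> 1")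
  case True
  then obtain m where "z = int (Suc m)" by (metis Suc_le_D nat_le_iff of_nat_1 zero_le_imp_eq_int
    nat_int of_nat_le_iff order_trans zero_le_one One_nat_def)
  then show ?thesis by (simp add: inverse_fact_def nat_add_distrib)
next
  case False
  then show ?thesis by (cases "z = 0") (auto simp: inverse_fact_def)
qed

definition inverse_fact_det :: "nat \<Rightarrow> (nat \<Rightarrow> int) \<Rightarrow> (nat \<Rightarrow> int) \<Rightarrow> real" where
  "inverse_fact_det k l m = det (mat k k (\<lambda>(i, j). inverse_fact (l i - m j)))"

lemma inverse_fact_det_Leibniz:
  "inverse_fact_det k l m =
     (\<Sum>p | p permutes {0..<k}. signof p * (\<Prod>i=0..<k. inverse_fact (l i - m (p i))))"
  unfolding inverse_fact_det_def det_def
  by (auto intro!: sum.cong prod.cong dest: permutes_in_image)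

text \<open>
  Lowering \<open>l\<^sub>i\<close> by one multiplies the term of a permutation \<open>p\<close> in the Leibniz expansion by
  \<open>l\<^sub>i - m\<^bsub>p(i)\<^esub>\<close>. Summed over \<open>i\<close>, these factors give \<open>\<Sum>l - \<Sum>m\<close> for every \<open>p\<close>.
\<close>

lemma sum_inverse_fact_det_pred:
  "(\<Sum>i=0..<k. inverse_fact_det k (l(i := l i - 1)) m) =
     of_int (\<Sum>i=0..<k. l i - m i) * inverse_fact_det k l m"
proof -
  let ?P = "\<lambda>p. \<Prod>j=0..<k. inverse_fact (l j - m (p j))"
  have row: "(\<Prod>j=0..<k. inverse_fact ((l(i := l i - 1)) j - m (p j))) =
      of_int (l i - m (p i)) * ?P p" if "i < k" for i p
  proof -
    have "inverse_fact (l i - 1 - m (p i)) = of_int (l i - m (p i)) * inverse_fact (l i - m (p i))"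
      using inverse_fact_pred[of "l i - m (p i)"] by (simp add: algebra_simps)
    then show ?thesis
      using that by (subst (1 2) prod.remove[of _ i]) (auto intro!: prod.cong)
  qed
  have weight: "(\<Sum>i=0..<k. l i - m (p i)) = (\<Sum>i=0..<k. l i - m i)" if "p permutes {0..<k}" for p
    using sum.permute[OF that, of m] by (simp add: sum_subtractf)
  have "(\<Sum>i=0..<k. inverse_fact_det k (l(i := l i - 1)) m) =
      (\<Sum>i=0..<k. \<Sum>p | p permutes {0..<k}. signof p * (of_int (l i - m (p i)) * ?P p))"
    unfolding inverse_fact_det_Leibniz by (intro sum.cong refl) (simp add: row del: fun_upd_apply of_int_diff)
  also have "\<dots> = (\<Sum>p | p permutes {0..<k}. \<Sum>i=0..<k. signof p * (of_int (l i - m (p i)) * ?P p))"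
    by (rule sum.swap)
  also have "\<dots> = (\<Sum>p | p permutes {0..<k}. of_int (\<Sum>i=0..<k. l i - m (p i)) * (signof p * ?P p))"
    by (intro sum.cong refl) (simp add: sum_distrib_left sum_distrib_right mult_ac)
  also have "\<dots> = of_int (\<Sum>i=0..<k. l i - m i) * inverse_fact_det k l m"
    unfolding inverse_fact_det_Leibniz sum_distrib_left by (intro sum.cong refl) (simp add: weight)
  finally show ?thesis .
qed

lemma inverse_fact_det_equal_rows:
  assumes "i < k" "i' < k" "i \<noteq> i'" "l i = l i'"
  shows "inverse_fact_det k l m = 0"
  unfolding inverse_fact_det_def
  by (rule det_identical_rows[of _ k i i']) (use assms in auto)

text \<open>
  The zero block has \<open>k - r\<close> rows and \<open>r + 1\<close> columns, too many for any permutation to avoid it.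
\<close>

lemma inverse_fact_det_zero_block:
  assumes r: "r < k" and zero: "\<And>i j. r \<le> i \<Longrightarrow> i < k \<Longrightarrow> j \<le> r \<Longrightarrow> l i < m j"
  shows "inverse_fact_det k l m = 0"
proof -
  have vanish: "(\<Prod>i=0..<k. inverse_fact (l i - m (p i))) = 0" if p: "p permutes {0..<k}" for p
  proof -
    have "\<exists>i\<in>{r..<k}. p i \<le> r"
    proof (rule ccontr)
      assume "\<not> ?thesis"
      then have "p ` {r..<k} \<subseteq> {Suc r..<k}"
        using permutes_in_image[OF p] by (auto simp: not_le Suc_le_eq)
      moreover have "card (p ` {r..<k}) = k - r"
        using permutes_inj_on[OF p] by (simp add: card_image)
      ultimately have "k - r \<le> card {Suc r..<k}" by (metis card_mono finite_atLeastLessThan)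
      then show False using r by simp
    qed
    then obtain i where "r \<le> i" "i < k" "p i \<le> r" by auto
    then have "inverse_fact (l i - m (p i)) = 0" using zero[of i "p i"] by (simp add: inverse_fact_def)
    then show ?thesis using \<open>i < k\<close> by (intro prod_zero) auto
  qed
  show ?thesis unfolding inverse_fact_det_Leibniz
    by (intro sum.neutral ballI) (use vanish in \<open>simp only: mem_Collect_eq mult_zero_right\<close>)
qed

lemma inverse_fact_det_strict_mono_self:
  assumes "\<And>i j. i < k \<Longrightarrow> j < i \<Longrightarrow> m i < m j"
  shows "inverse_fact_det k m m = 1"
proof -
  let ?A = "mat k k (\<lambda>(i, j). inverse_fact (m i - m j))"
  have "det ?A = prod_list (diag_mat ?A)"
    by (rule det_upper_triangular[of _ k])
       (use assms in \<open>auto simp: inverse_fact_def upper_triangular_def\<close>)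
  also have "diag_mat ?A = replicate k 1"
    by (rule nth_equalityI) (auto simp: diag_mat_def inverse_fact_def)
  finally show ?thesis by (simp add: inverse_fact_det_def)
qed

section \<open>Standard tableaux of skew shape\<close>

definition skew_cells :: "nat \<Rightarrow> (nat \<Rightarrow> int) \<Rightarrow> (nat \<Rightarrow> int) \<Rightarrow> (nat \<times> int) set" where
  "skew_cells k \<mu> \<nu> = (SIGMA i:{0..<k}. {\<mu> i<..\<nu> i})"

text \<open>
  Only neighbouring cells are related. In a skew shape these relations generate the order of the
  cells, and they leave the maximal cells directly visible.
\<close>

definition cell_covers :: "((nat \<times> int) \<times> (nat \<times> int)) set" where
  "cell_covers = {((i, c), (i', c')). i' = i \<and> c' = c + 1 \<or> i' = Suc i \<and> c' = c}"

lemma antimono_below: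
  fixes f :: "nat \<Rightarrow> int"
  assumes "\<And>i. Suc i < k \<Longrightarrow> f (Suc i) \<le> f i" "i \<le> j" "j < k"
  shows "f j \<le> f i"
  using assms(2,3)
proof (induction j rule: dec_induct)
  case (step j)
  then show ?case using assms(1)[of j] by simp
qed simp

text \<open>
  Since \<open>\<mu>\<close> decreases weakly, the last cell of a row has no cell below it exactly if the next row
  ends further left.
\<close>

lemma maximal_skew_cells:
  assumes \<mu>: "\<And>i. Suc i < k \<Longrightarrow> \<mu> (Suc i) \<le> \<mu> i"
  shows "{x \<in> skew_cells k \<mu> \<nu>. \<forall>y\<in>skew_cells k \<mu> \<nu>. (x, y) \<notin> cell_covers} =
    (\<lambda>i. (i, \<nu> i)) ` {i. i < k \<and> \<mu> i < \<nu> i \<and> (Suc i < k \<longrightarrow> \<nu> (Suc i) < \<nu> i)}"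
  (is "?L = ?R")
proof (rule Set.set_eqI, clarify)
  fix i c
  have "(i, c) \<in> ?L \<longleftrightarrow> (i, c) \<in> skew_cells k \<mu> \<nu> \<and> (i, c + 1) \<notin> skew_cells k \<mu> \<nu> \<and>
      (Suc i, c) \<notin> skew_cells k \<mu> \<nu>"
    by (auto simp: cell_covers_def)
  also have "\<dots> \<longleftrightarrow> i < k \<and> \<mu> i < c \<and> c = \<nu> i \<and> (Suc i < k \<longrightarrow> \<nu> (Suc i) < c)"
    using \<mu>[of i] by (auto simp: skew_cells_def)
  also have "\<dots> \<longleftrightarrow> (i, c) \<in> ?R" by auto
  finally show "(i, c) \<in> ?L \<longleftrightarrow> (i, c) \<in> ?R" .
qed

lemma skew_cells_remove_corner:
  assumes "i < k" "\<mu> i < \<nu> i"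
  shows "skew_cells k \<mu> \<nu> - {(i, \<nu> i)} = skew_cells k \<mu> (\<nu>(i := \<nu> i - 1))"
  using assms by (auto simp: skew_cells_def split: if_splits)

lemma card_skew_cells:
  assumes "\<And>i. i < k \<Longrightarrow> \<mu> i \<le> \<nu> i"
  shows "int (card (skew_cells k \<mu> \<nu>)) = (\<Sum>i=0..<k. \<nu> i - \<mu> i)"
  using assms by (simp add: skew_cells_def)

text \<open>
  Aitken's determinant formula. The row ends enter as \<open>\<nu>\<^sub>i - i\<close> and \<open>\<mu>\<^sub>j - j\<close>, which strictly decrease:
  this makes the matrix triangular for the empty shape, and it makes two rows of the matrix
  coincide when a row is cut one cell shorter than the next.
\<close>

theorem card_skew_tableaux:
  assumes "\<And>i. i < k \<Longrightarrow> \<mu> i \<le> \<nu> i"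
    and "\<And>i. Suc i < k \<Longrightarrow> \<mu> (Suc i) \<le> \<mu> i"
    and "\<And>i. Suc i < k \<Longrightarrow> \<nu> (Suc i) \<le> \<nu> i"
  shows "real (card (linear_extensions (skew_cells k \<mu> \<nu>) cell_covers)) =
    fact (card (skew_cells k \<mu> \<nu>)) *
      inverse_fact_det k (\<lambda>i. \<nu> i - int i) (\<lambda>j. \<mu> j - int j)"
  using assms(1,3)
proof (induction "card (skew_cells k \<mu> \<nu>)" arbitrary: \<nu>)
  case 0
  have fin: "finite (skew_cells k \<mu> \<nu>)" by (simp add: skew_cells_def)
  then have empty: "skew_cells k \<mu> \<nu> = {}" using 0 by simp
  have "\<nu> i = \<mu> i" if "i < k" for i
  proof -
    have "(i, \<nu> i) \<notin> skew_cells k \<mu> \<nu>" using empty by simp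
    then show ?thesis using 0(2)[OF that] that by (simp add: skew_cells_def)
  qed
  then have "inverse_fact_det k (\<lambda>i. \<nu> i - int i) (\<lambda>j. \<mu> j - int j) =
      inverse_fact_det k (\<lambda>j. \<mu> j - int j) (\<lambda>j. \<mu> j - int j)"
    unfolding inverse_fact_det_def by (intro arg_cong[where f = det] cong_mat) auto
  also have "\<dots> = 1"
  proof (rule inverse_fact_det_strict_mono_self)
    fix i j :: nat assume "i < k" "j < i"
    then show "\<mu> i - int i < \<mu> j - int j" using antimono_below[of k \<mu> j i] assms(2) by simp
  qed
  finally show ?case by (simp add: empty)
next
  case (Suc n)
  let ?C = "\<lambda>\<nu>. skew_cells k \<mu> \<nu>"
  let ?N = "\<lambda>\<nu>. real (card (linear_extensions (?C \<nu>) cell_covers))"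
  let ?g = "\<lambda>\<nu>. inverse_fact_det k (\<lambda>i. \<nu> i - int i) (\<lambda>j. \<mu> j - int j)"
  let ?down = "\<lambda>i. \<nu>(i := \<nu> i - 1)"
  let ?I = "{i. i < k \<and> \<mu> i < \<nu> i \<and> (Suc i < k \<longrightarrow> \<nu> (Suc i) < \<nu> i)}"
  have fin: "finite (?C \<nu>)" by (simp add: skew_cells_def)
  have corner: "?N (?down i) = fact n * ?g (?down i)" if i: "i \<in> ?I" for i
  proof -
    have "card (?C (?down i)) = n"
    proof -
      have "(i, \<nu> i) \<in> ?C \<nu>" using i by (simp add: skew_cells_def)
      then have "card (?C \<nu> - {(i, \<nu> i)}) = n" using Suc(2) fin by simp
      moreover have "?C \<nu> - {(i, \<nu> i)} = ?C (?down i)"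
        using i by (intro skew_cells_remove_corner) auto
      ultimately show ?thesis by simp
    qed
    moreover have "\<mu> j \<le> (?down i) j" if "j < k" for j using that i Suc.prems(1)[of j] by auto
    moreover have "(?down i) (Suc j) \<le> (?down i) j" if "Suc j < k" for j
      using that i Suc.prems(2)[of j] by auto
    ultimately show ?thesis using Suc.hyps(1)[of "?down i"] by simp
  qed
  have no_corner: "?g (?down i) = 0" if i: "i \<in> {0..<k} - ?I" for i
  proof (cases "Suc i < k \<and> \<nu> (Suc i) = \<nu> i")
    case True
    then show ?thesis by (intro inverse_fact_det_equal_rows[of i _ "Suc i"]) auto
  next
    case False
    \<comment> \<open>The row is empty, so after lowering its end all rows from it on end left of the starts of the rows up to it.\<close>
    have empty_row: "\<mu> i = \<nu> i"
      using i False Suc.prems(1)[of i] Suc.prems(2)[of i] by force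
    have mono: "(?down i) (Suc j) \<le> (?down i) j" if "Suc j < k" for j
      using that False Suc.prems(2)[of j] by auto
    show ?thesis
    proof (rule inverse_fact_det_zero_block[of i])
      fix i' j assume *: "i \<le> i'" "i' < k" "j \<le> i"
      have "(?down i) i' \<le> (?down i) i" using antimono_below[of k "?down i", OF mono] * by blast
      moreover have "\<mu> i \<le> \<mu> j" using antimono_below[of k \<mu> j i] assms(2) * by simp
      ultimately show "(?down i) i' - int i' < \<mu> j - int j" using empty_row * by simp
    qed (use i in auto)
  qed
  have "?N \<nu> = (\<Sum>x | x \<in> ?C \<nu> \<and> (\<forall>y\<in>?C \<nu>. (x, y) \<notin> cell_covers).
      real (card (linear_extensions (?C \<nu> - {x}) cell_covers)))"
    using Suc(2) by (subst card_linear_extensions[OF fin]) auto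
  also have "\<dots> = (\<Sum>i\<in>?I. real (card (linear_extensions (?C \<nu> - {(i, \<nu> i)}) cell_covers)))"
    by (subst maximal_skew_cells) (use assms(2) in \<open>auto simp: sum.reindex inj_on_def\<close>)
  also have "\<dots> = (\<Sum>i\<in>?I. ?N (?down i))"
    by (intro sum.cong refl) (simp add: skew_cells_remove_corner)
  also have "\<dots> = (\<Sum>i\<in>?I. fact n * ?g (?down i))" using corner by (intro sum.cong refl)
  \<comment> \<open>The rows without a corner contribute zero, so the sum may run over all rows.\<close>
  also have "\<dots> = (\<Sum>i=0..<k. fact n * ?g (?down i))"
    using no_corner by (intro sum.mono_neutral_left) auto
  also have "\<dots> = fact n * (\<Sum>i=0..<k. ?g (?down i))" by (simp add: sum_distrib_left)
  also have "(\<Sum>i=0..<k. ?g (?down i)) = (\<Sum>i=0..<k. inverse_fact_det k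
      ((\<lambda>i. \<nu> i - int i)(i := (\<nu> i - int i) - 1)) (\<lambda>j. \<mu> j - int j))"
    by (intro sum.cong refl arg_cong[where f = "\<lambda>l. inverse_fact_det k l _"]) auto
  also have "\<dots> = of_int (\<Sum>i=0..<k. \<nu> i - \<mu> i) * ?g \<nu>"
    by (subst sum_inverse_fact_det_pred) simp
  also have "(\<Sum>i=0..<k. \<nu> i - \<mu> i) = int (Suc n)"
    using card_skew_cells[OF Suc.prems(1)] Suc(2) by simp
  finally show ?case using Suc(2)[symmetric] by simp
qed

section \<open>Increasing steps of minimal permutations\<close>

text \<open>
  The positions at which a maximal decreasing run begins. Position 0 is included, so that the number
  of runs is the cardinality.
\<close>

definition run_starts :: "nat list \<Rightarrow> nat set" where
  "run_starts s = {p. p < length s \<and> (p = 0 \<or> s ! (p - 1) < s ! p)}"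

lemma descents_append:
  assumes "u \<noteq> []" "v \<noteq> []"
  shows "descents (u @ v) = descents u + descents v + of_bool (last u > hd v)"
  using assms
proof (induction u rule: induct_list012)
  case (2 x)
  then show ?case by (cases v) auto
qed auto

lemma descents_plus_run_starts:
  assumes "distinct s"
  shows "descents s + card (run_starts s) = length s"
proof -
  let ?D = "{i. Suc i < length s \<and> s ! i > s ! Suc i}"
  have "Suc ` ?D \<union> run_starts s = {..<length s}" (is "?L = _")
  proof (rule Set.set_eqI)
    fix p show "p \<in> ?L \<longleftrightarrow> p \<in> {..<length s}"
    proof (cases p)
      case (Suc q)
      have "s ! q \<noteq> s ! Suc q" if "Suc q < length s"
        using that assms by (simp add: nth_eq_iff_index_eq)
      then show ?thesis using Suc by (auto simp: run_starts_def)
    qed (auto simp: run_starts_def)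
  qed
  moreover have "Suc ` ?D \<inter> run_starts s = {}" by (auto simp: run_starts_def)
  moreover have "finite ?D" "finite (run_starts s)"
    by (rule finite_subset[of _ "{..<length s}"]; auto simp: run_starts_def)+
  ultimately have "card (Suc ` ?D) + card (run_starts s) = card {..<length s}"
    using card_Un_disjoint[of "Suc ` ?D" "run_starts s"] by simp
  then show ?thesis by (simp add: descents_def card_image)
qed

text \<open>
  Removing an inner entry replaces the two steps at it by a single one. One descent is lost exactly
  if both steps are descents, or one of them is and the merged step is an ascent. The removal of a
  first or last entry loses a descent exactly if the only step at it is one; the condition
  \<open>i + 2 \<le> length s\<close> accounts for the last entry, and position 0 as a run start for the first.
\<close>

lemma descents_remove_at:
  assumes dist: "distinct s" and i: "i < length s"
  shows "descents (remove_at i s) + 1 = descents s \<longleftrightarrow>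
    (i \<in> run_starts s \<longrightarrow> Suc i \<notin> run_starts s \<and> i + 2 \<le> length s) \<and>
    (\<forall>p. i = Suc p \<and> p + 2 < length s \<and> (Suc p \<in> run_starts s \<or> p + 2 \<in> run_starts s) \<longrightarrow>
       s ! p < s ! (p + 2))"
proof -
  define u x v where "u = take i s" and "x = s ! i" and "v = drop (Suc i) s"
  have s: "s = u @ x # v" unfolding u_def x_def v_def using i by (rule id_take_nth_drop)
  have rem: "remove_at i s = u @ v" by (simp add: remove_at_def u_def v_def)
  have len: "length u = i" using i by (simp add: u_def)
  show ?thesis
  proof (cases u rule: rev_cases)
    case Nil
    then show ?thesis
      using dist len unfolding rem unfolding s by (cases v) (auto simp: run_starts_def)
  next
    case u: (snoc u' w)
    show ?thesis
    proof (cases v)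
      case Nil
      moreover have "descents (u' @ [w, x]) = descents (u' @ [w]) + of_bool (w > x)"
        using descents_append[of "u' @ [w]" "[x]"] by simp
      ultimately show ?thesis using dist len unfolding rem unfolding s u
        by (auto simp: run_starts_def nth_append)
    next
      case v: (Cons y v')
      have "s ! (i - 1) = w" "s ! i = x" "s ! Suc i = y" "i > 0" "Suc i < length s"
        unfolding s u v using len u by (auto simp: nth_append)
      moreover from this have "i \<in> run_starts s \<longleftrightarrow> w < x" "Suc i \<in> run_starts s \<longleftrightarrow> x < y"
        by (auto simp: run_starts_def)
      moreover have "w \<noteq> x" "x \<noteq> y" "w \<noteq> y" using dist unfolding s u v by auto
      moreover have "descents s = descents u + descents v + of_bool (w > x) + of_bool (x > y)"
        unfolding s by (subst descents_append) (auto simp: u v)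
      moreover have "descents (u @ v) = descents u + descents v + of_bool (w > y)"
        by (subst descents_append) (auto simp: u v)
      ultimately show ?thesis unfolding rem by (cases i) auto
    qed
  qed
qed

lemma minimal_perm_iff_run_starts:
  assumes perm: "is_perm s"
  shows "minimal_perm d s \<longleftrightarrow> descents s = d \<and>
    (\<forall>p\<in>run_starts s. Suc p \<notin> run_starts s \<and> p + 2 \<le> length s) \<and>
    (\<forall>p. p + 2 < length s \<and> (Suc p \<in> run_starts s \<or> p + 2 \<in> run_starts s) \<longrightarrow>
       s ! p < s ! (p + 2))"
proof -
  have dist: "distinct s" using perm by (simp add: is_perm_def permutations_of_set_def)
  have sub: "p < length s" if "p \<in> run_starts s" for p using that by (simp add: run_starts_def)
  have lt: "Suc p < length s" if "p + 2 < length s" for p using that by simp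
  have "minimal_perm d s \<longleftrightarrow> descents s = d \<and>
      (\<forall>i<length s. descents (remove_at i s) + 1 = descents s)"
    unfolding minimal_perm_iff_remove_at[OF perm]
    by (auto simp: descents_order_isomorphic[OF order_isomorphic_standardize])
  also have "\<dots> \<longleftrightarrow> descents s = d \<and>
    (\<forall>i<length s. (i \<in> run_starts s \<longrightarrow> Suc i \<notin> run_starts s \<and> i + 2 \<le> length s) \<and>
      (\<forall>p. i = Suc p \<and> p + 2 < length s \<and> (Suc p \<in> run_starts s \<or> p + 2 \<in> run_starts s) \<longrightarrow>
         s ! p < s ! (p + 2)))"
    using descents_remove_at[OF dist] by simp
  also have "\<dots> \<longleftrightarrow> descents s = d \<and>
    (\<forall>p\<in>run_starts s. Suc p \<notin> run_starts s \<and> p + 2 \<le> length s) \<and>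
    (\<forall>p. p + 2 < length s \<and> (Suc p \<in> run_starts s \<or> p + 2 \<in> run_starts s) \<longrightarrow>
       s ! p < s ! (p + 2))"
    using sub lt by blast
  finally show ?thesis .
qed

section \<open>Compositions and their partial sums\<close>

definition offset :: "nat list \<Rightarrow> nat \<Rightarrow> nat" where
  "offset a i = sum_list (take i a)"

text \<open>
  Consecutive blocks of lengths \<open>a\<close> that tile \<open>{0..<sum_list a}\<close>; block \<open>i\<close> occupies the positions
  from \<open>offset a i\<close> up to, but excluding, \<open>offset a (Suc i)\<close>.
\<close>

definition block_starts :: "nat list \<Rightarrow> nat set" where
  "block_starts a = offset a ` {..<length a}"

lemma offset_0 [simp]: "offset a 0 = 0"
  by (simp add: offset_def)

lemma offset_length [simp]: "offset a (length a) = sum_list a"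
  by (simp add: offset_def)

lemma offset_Suc: "i < length a \<Longrightarrow> offset a (Suc i) = offset a i + a ! i"
  by (simp add: offset_def take_Suc_conv_app_nth)

lemma offset_mono: "i \<le> j \<Longrightarrow> offset a i \<le> offset a j"
proof (rule lift_Suc_mono_le[of "offset a"])
  fix i show "offset a i \<le> offset a (Suc i)"
    by (cases "i < length a") (auto simp: offset_Suc, simp add: offset_def)
qed

lemma block_starts_Nil [simp]: "block_starts [] = {}"
  by (simp add: block_starts_def)

lemma block_starts_Cons [simp]: "block_starts (x # a) = insert 0 ((+) x ` block_starts a)"
  by (simp add: block_starts_def lessThan_Suc_eq_insert_0 image_image offset_def)

lemma zero_in_block_starts: "a \<noteq> [] \<Longrightarrow> 0 \<in> block_starts a"
  by (cases a) auto

lemma card_block_starts: "\<forall>x\<in>set a. 1 \<le> x \<Longrightarrow> card (block_starts a) = length a"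
proof (induction a)
  case (Cons x a)
  have "finite (block_starts a)" by (simp add: block_starts_def)
  then show ?case using Cons by (auto simp: card_image card_insert_if)
qed simp

text \<open>
  If there is more than one block, the length of the first is the least nonzero start; the common
  sum determines the length of a single block.
\<close>

lemma block_starts_inject:
  assumes "\<forall>x\<in>set a. 1 \<le> x" "\<forall>x\<in>set b. 1 \<le> x" "sum_list a = sum_list b"
    and "block_starts a = block_starts b"
  shows "a = b"
  using assms
proof (induction a arbitrary: b)
  case Nil
  then show ?case by (cases b) auto
next
  case (Cons x a)
  obtain y b' where b: "b = y # b'" using Cons.prems(4) by (cases b) auto
  have starts: "insert 0 ((+) x ` block_starts a) = insert 0 ((+) y ` block_starts b')"
    using Cons.prems(4) b by simp
  have pos: "x \<ge> 1" "y \<ge> 1" using Cons.prems b by auto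
  have eq: "(+) x ` block_starts a = (+) y ` block_starts b'"
  proof -
    have "(+) x ` block_starts a = insert 0 ((+) x ` block_starts a) - {0}" using pos by auto
    also have "\<dots> = insert 0 ((+) y ` block_starts b') - {0}" by (simp only: starts)
    also have "\<dots> = (+) y ` block_starts b'" using pos by auto
    finally show ?thesis .
  qed
  have len: "length a = length b'"
    using eq Cons.prems(1,2) b card_block_starts[of a] card_block_starts[of b']
    by (metis card_image inj_on_add list.set_intros(2))
  show ?case
  proof (cases "a = []")
    case True
    then show ?thesis using len Cons.prems(3) b by simp
  next
    case False
    then have "0 \<in> block_starts a" "0 \<in> block_starts b'"
      using len by (auto intro!: zero_in_block_starts)
    then have "x \<in> (+) y ` block_starts b'" "y \<in> (+) x ` block_starts a"
      using eq by (metis add_0_right image_eqI)+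
    then have "x = y" by auto
    moreover from this eq have "block_starts a = block_starts b'"
      by (simp add: inj_image_eq_iff)
    ultimately show ?thesis using Cons b by auto
  qed
qed

text \<open>
  Prepending an entry opens a new block of length 1 if it is followed by an ascent and otherwise
  lengthens the first block.
\<close>

lemma ex_composition_run_starts:
  "\<exists>a. (\<forall>x\<in>set a. 1 \<le> x) \<and> sum_list a = length s \<and> block_starts a = run_starts s"
proof (induction s rule: induct_list012)
  case 1
  show ?case by (rule exI[of _ "[]"]) (simp add: run_starts_def)
next
  case (2 x)
  show ?case by (rule exI[of _ "[1]"]) (auto simp: run_starts_def)
next
  case (3 x y s)
  then obtain a where a: "\<forall>x\<in>set a. 1 \<le> x" "sum_list a = length (y # s)"
    "block_starts a = run_starts (y # s)" by blast
  have rs: "run_starts (x # y # s) =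
    insert 0 (Suc ` (if x < y then run_starts (y # s) else run_starts (y # s) - {0}))"
    (is "?L = ?R")
  proof (rule Set.set_eqI)
    fix p show "p \<in> ?L \<longleftrightarrow> p \<in> ?R"
    proof (cases p)
      case (Suc q)
      then show ?thesis by (cases q) (auto simp: run_starts_def)
    qed (auto simp: run_starts_def)
  qed
  show ?case
  proof (cases "x < y")
    case True
    then show ?thesis using a rs by (intro exI[of _ "1 # a"]) auto
  next
    case False
    obtain h t where ht: "a = h # t" using a(2) by (cases a) auto
    have "block_starts a - {0} = (+) h ` block_starts t" using a(1) ht by auto
    then have "block_starts (Suc h # t) = insert 0 (Suc ` (block_starts a - {0}))"
      by (simp add: image_image)
    also have "\<dots> = run_starts (x # y # s)" unfolding rs a(3) using False by simp
    finally have "block_starts (Suc h # t) = run_starts (x # y # s)" .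
    moreover have "\<forall>x\<in>set (Suc h # t). 1 \<le> x" "sum_list (Suc h # t) = length (x # y # s)"
      using a(1,2) ht by auto
    ultimately show ?thesis by blast
  qed
qed

lemma block_starts_spaced:
  assumes "\<forall>x\<in>set a. 2 \<le> x" "p \<in> block_starts a"
  shows "Suc p \<notin> block_starts a \<and> p + 2 \<le> sum_list a"
  using assms
proof (induction a arbitrary: p)
  case (Cons x a)
  show ?case
  proof (cases "p = 0")
    case True
    then show ?thesis using Cons.prems by auto
  next
    case False
    then obtain q where "p = x + q" "q \<in> block_starts a" using Cons.prems by auto
    then show ?thesis using Cons by fastforce
  qed
qed simp

text \<open>
  A block of length 1 either makes two starts adjacent or, as last block, starts at the last
  position.
\<close>

lemma spaced_block_starts:
  assumes "\<forall>x\<in>set a. 1 \<le> x"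
    and "\<forall>p\<in>block_starts a. Suc p \<notin> block_starts a \<and> p + 2 \<le> sum_list a"
  shows "\<forall>x\<in>set a. 2 \<le> x"
  using assms
proof (induction a)
  case (Cons x a)
  have "x \<noteq> 1"
  proof
    assume "x = 1"
    then show False using Cons.prems(2) zero_in_block_starts[of a] by (cases "a = []") auto
  qed
  moreover have "1 \<le> x" using Cons.prems(1) by simp
  ultimately have "2 \<le> x" by linarith
  moreover have "\<forall>x\<in>set a. 2 \<le> x"
  proof (rule Cons.IH)
    show "\<forall>p\<in>block_starts a. Suc p \<notin> block_starts a \<and> p + 2 \<le> sum_list a"
    proof
      fix p assume "p \<in> block_starts a"
      then have "Suc (x + p) \<notin> block_starts (x # a) \<and> x + p + 2 \<le> sum_list (x # a)"
        using Cons.prems(2) by simp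
      then show "Suc p \<notin> block_starts a \<and> p + 2 \<le> sum_list a"
        by (auto simp: image_iff)
    qed
  qed (use Cons.prems(1) in simp)
  ultimately show ?case by simp
qed simp

lemma obtain_block:
  assumes "p < sum_list a"
  obtains i where "i < length a" "offset a i \<le> p" "p < offset a (Suc i)"
proof -
  have "\<exists>i<m. offset a i \<le> p \<and> p < offset a (Suc i)" if "p < offset a m" for m
    using that
  proof (induction m)
    case (Suc m)
    then show ?case by (cases "p < offset a m") (auto simp: less_Suc_eq)
  qed simp
  from this[of "length a"] show ?thesis using assms that by auto
qed

lemma offset_in_block:
  assumes "offset a i \<le> p" "p < offset a (Suc i)" "offset a j \<le> p" "p < offset a (Suc j)"
  shows "i = j"
proof (rule ccontr)
  assume "i \<noteq> j"
  then consider "Suc i \<le> j" | "Suc j \<le> i" by linarith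
  then show False using assms offset_mono[of "Suc i" j a] offset_mono[of "Suc j" i a] by cases auto
qed

lemma same_block_iff:
  "(\<exists>i<length a. offset a i \<le> p \<and> Suc p < offset a (Suc i)) \<longleftrightarrow>
     Suc p < sum_list a \<and> Suc p \<notin> block_starts a"
proof
  assume "\<exists>i<length a. offset a i \<le> p \<and> Suc p < offset a (Suc i)"
  then obtain i where i: "i < length a" "offset a i \<le> p" "Suc p < offset a (Suc i)" by blast
  have "offset a j \<noteq> Suc p" for j
    using i offset_mono[of j i a] offset_mono[of "Suc i" j a] by (cases "j \<le> i") auto
  moreover have "offset a (Suc i) \<le> sum_list a" using offset_mono[of "Suc i" "length a" a] i by simp
  ultimately show "Suc p < sum_list a \<and> Suc p \<notin> block_starts a"
    using i by (force simp: block_starts_def)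
next
  assume *: "Suc p < sum_list a \<and> Suc p \<notin> block_starts a"
  then obtain i where i: "i < length a" "offset a i \<le> p" "p < offset a (Suc i)"
    using obtain_block[of p a] by auto
  have "Suc p \<noteq> offset a (Suc i)"
    using * i by (cases "Suc i = length a") (auto simp: block_starts_def simp flip: offset_length)
  then show "\<exists>i<length a. offset a i \<le> p \<and> Suc p < offset a (Suc i)" using i by force
qed

text \<open>
  Blocks of length at least 2 cannot be skipped by a jump of two positions, so \<open>p\<close> and \<open>p + 2\<close> lie
  in the same block or in adjacent ones.
\<close>

lemma next_block_iff:
  assumes a: "\<forall>x\<in>set a. 2 \<le> x"
  shows "(\<exists>i. Suc i < length a \<and> offset a i \<le> p \<and> p < offset a (Suc i) \<and>
      offset a (Suc i) \<le> p + 2 \<and> p + 2 < offset a (Suc (Suc i))) \<longleftrightarrow>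
    p + 2 < sum_list a \<and> (Suc p \<in> block_starts a \<or> p + 2 \<in> block_starts a)" (is "?L \<longleftrightarrow> ?R")
proof
  assume ?L
  then obtain i where i: "Suc i < length a" "offset a i \<le> p" "p < offset a (Suc i)"
      "offset a (Suc i) \<le> p + 2" "p + 2 < offset a (Suc (Suc i))" by blast
  moreover have "offset a (Suc (Suc i)) \<le> sum_list a"
    using offset_mono[of "Suc (Suc i)" "length a" a] i by simp
  moreover have "offset a (Suc i) \<in> block_starts a" using i by (simp add: block_starts_def)
  moreover have "offset a (Suc i) = Suc p \<or> offset a (Suc i) = p + 2" using i by linarith
  ultimately show ?R by auto
next
  assume R: ?R
  then obtain j where j: "j < length a" "offset a j = Suc p \<or> offset a j = p + 2"
    by (auto simp: block_starts_def)
  then obtain i where i: "j = Suc i" by (cases j) auto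
  have "a ! i \<ge> 2" "a ! j \<ge> 2" using a i j by auto
  then have "offset a i + 2 \<le> offset a j" "offset a j + 2 \<le> offset a (Suc j)"
    using offset_Suc[of i a] offset_Suc[of j a] i j by auto
  then show ?L using i j by (intro exI[of _ i]) auto
qed

section \<open>Minimal permutations as tableaux\<close>

text \<open>
  Along a bijection from the elements to the positions, a labelling by \<open>1, \<dots>, n\<close> is the same
  thing as a permutation in one-line notation.
\<close>

lemma card_linear_extensions_permutations:
  assumes pos: "bij_betw pos C {0..<n}"
  shows "card {s \<in> permutations_of_set {1..n}.
      \<forall>x\<in>C. \<forall>y\<in>C. (x, y) \<in> R \<longrightarrow> s ! pos x < s ! pos y} = card (linear_extensions C R)"
    (is "card ?S = _")
proof (rule bij_betw_same_card[of "\<lambda>s. restrict (\<lambda>x. s ! pos x) C"],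
       rule bij_betw_byWitness[where f' = "\<lambda>f. map (f \<circ> inv_into C pos) [0..<n]"])
  have card: "card C = n" using bij_betw_same_card[OF pos] by simp
  have posC: "pos x < n" if "x \<in> C" for x using bij_betwE[OF pos] that by auto
  have inv: "inv_into C pos p \<in> C" "pos (inv_into C pos p) = p" if "p < n" for p
    using that bij_betwE[OF bij_betw_inv_into[OF pos]] bij_betw_inv_into_right[OF pos] by auto
  have inv_pos: "inv_into C pos (pos x) = x" if "x \<in> C" for x
    using that bij_betw_inv_into_left[OF pos] by simp
  have len: "length s = n" if "s \<in> permutations_of_set {1..n}" for s :: "nat list"
    using length_finite_permutations_of_set[OF that] by simp
  show "\<forall>s\<in>?S. map (restrict (\<lambda>x. s ! pos x) C \<circ> inv_into C pos) [0..<n] = s"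
    by (auto intro!: nth_equalityI simp: len inv)
  show "\<forall>f\<in>linear_extensions C R.
      restrict (\<lambda>x. map (f \<circ> inv_into C pos) [0..<n] ! pos x) C = f"
    by (auto simp: linear_extensions_def posC inv_pos fun_eq_iff restrict_def extensional_def)
  show "(\<lambda>s. restrict (\<lambda>x. s ! pos x) C) ` ?S \<subseteq> linear_extensions C R"
  proof (rule image_subsetI)
    fix s assume s: "s \<in> ?S"
    then have "bij_betw ((!) s) {0..<n} {1..n}"
      using len by (intro bij_betw_nth) (auto simp: permutations_of_set_def)
    then have "bij_betw ((!) s \<circ> pos) C {1..n}" by (rule bij_betw_trans[OF pos])
    moreover have "bij_betw ((!) s \<circ> pos) C {1..n} =
        bij_betw (restrict (\<lambda>x. s ! pos x) C) C {1..n}" by (rule bij_betw_cong) simp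
    ultimately show "restrict (\<lambda>x. s ! pos x) C \<in> linear_extensions C R"
      using s by (simp add: linear_extensions_def card)
  qed
  show "(\<lambda>f. map (f \<circ> inv_into C pos) [0..<n]) ` linear_extensions C R \<subseteq> ?S"
  proof (rule image_subsetI)
    fix f assume f: "f \<in> linear_extensions C R"
    then have "bij_betw f C {1..n}" by (simp add: linear_extensions_def card)
    then have "bij_betw (f \<circ> inv_into C pos) {0..<n} {1..n}"
      by (rule bij_betw_trans[OF bij_betw_inv_into[OF pos]])
    then have "map (f \<circ> inv_into C pos) [0..<n] \<in> permutations_of_set {1..n}"
      by (auto simp: permutations_of_set_def distinct_map bij_betw_def)
    then show "map (f \<circ> inv_into C pos) [0..<n] \<in> ?S"
      using f by (auto simp: linear_extensions_def posC inv_pos)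
  qed
qed

text \<open>
  The entry at position \<open>p\<close> of a permutation, in run \<open>i\<close>, is placed in row \<open>i\<close> and column
  \<open>2 * i - p\<close>. A step to the right in a row is then a step from \<open>p\<close> to \<open>p - 1\<close>, a step down a column
  is one from \<open>p\<close> to \<open>p + 2\<close>, and each row overlaps the next in two columns. Columns are integers
  since these coordinates become negative.
\<close>

definition row_end :: "nat list \<Rightarrow> nat \<Rightarrow> int" where
  "row_end a i = 2 * int i - int (offset a i)"

definition row_begin :: "nat list \<Rightarrow> nat \<Rightarrow> int" where
  "row_begin a i = 2 * int i - int (offset a (Suc i))"

abbreviation run_cells :: "nat list \<Rightarrow> (nat \<times> int) set" where
  "run_cells a \<equiv> skew_cells (length a) (row_begin a) (row_end a)"

definition cell_position :: "nat \<times> int \<Rightarrow> nat" where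
  "cell_position x = nat (2 * int (fst x) - snd x)"

lemma cell_at_position:
  "(i, 2 * int i - int p) \<in> run_cells a \<longleftrightarrow>
     i < length a \<and> offset a i \<le> p \<and> p < offset a (Suc i)"
  by (auto simp: skew_cells_def row_begin_def row_end_def)

lemma run_cellE:
  assumes "(i, c) \<in> run_cells a"
  obtains p where "c = 2 * int i - int p"
proof
  have "c \<le> 2 * int i" using assms by (simp add: skew_cells_def row_end_def)
  then show "c = 2 * int i - int (nat (2 * int i - c))" by simp
qed

lemma cell_position_at [simp]: "cell_position (i, 2 * int i - int p) = p"
  by (simp add: cell_position_def)

text \<open>
  The row is recovered from the position because the blocks are disjoint; it determines the column.
\<close>

lemma bij_betw_cell_position: "bij_betw cell_position (run_cells a) {0..<sum_list a}"
  unfolding bij_betw_def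
proof
  show "inj_on cell_position (run_cells a)"
  proof (rule inj_onI, clarify)
    fix i c i' c'
    assume *: "(i, c) \<in> run_cells a" "(i', c') \<in> run_cells a"
      "cell_position (i, c) = cell_position (i', c')"
    obtain p p' where p: "c = 2 * int i - int p" "c' = 2 * int i' - int p'"
      using * by (blast elim: run_cellE)
    then have "p = p'" using * by simp
    then show "i = i' \<and> c = c'"
      using * offset_in_block[of a i p i'] unfolding p cell_at_position by simp
  qed
  show "cell_position ` run_cells a = {0..<sum_list a}"
  proof (intro equalityI subsetI)
    fix q assume "q \<in> cell_position ` run_cells a"
    then obtain i c where ic: "(i, c) \<in> run_cells a" "q = cell_position (i, c)" by auto
    then obtain p where "c = 2 * int i - int p" by (blast elim: run_cellE)
    then have "i < length a" "q < offset a (Suc i)" using ic cell_at_position by auto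
    then show "q \<in> {0..<sum_list a}" using offset_mono[of "Suc i" "length a" a] by simp
  next
    fix p assume "p \<in> {0..<sum_list a}"
    then obtain i where "(i, 2 * int i - int p) \<in> run_cells a"
      by (auto simp: cell_at_position intro: obtain_block[of p a])
    then show "p \<in> cell_position ` run_cells a" by (force intro: rev_image_eqI)
  qed
qed

text \<open>
  Steps within a row are the descents inside the runs, steps down a column are the comparisons
  across a boundary between two runs.
\<close>

lemma covers_increasing_iff:
  assumes a: "\<forall>x\<in>set a. 2 \<le> x"
  shows "(\<forall>x\<in>run_cells a. \<forall>y\<in>run_cells a. (x, y) \<in> cell_covers \<longrightarrow>
      s ! cell_position x < s ! cell_position y) \<longleftrightarrow>
    (\<forall>p. Suc p < sum_list a \<and> Suc p \<notin> block_starts a \<longrightarrow> s ! Suc p < s ! p) \<and>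
    (\<forall>p. p + 2 < sum_list a \<and> (Suc p \<in> block_starts a \<or> p + 2 \<in> block_starts a) \<longrightarrow>
       s ! p < s ! (p + 2))" (is "?L \<longleftrightarrow> ?R")
proof
  assume L: ?L
  have "s ! Suc p < s ! p" if p: "Suc p < sum_list a \<and> Suc p \<notin> block_starts a" for p
  proof -
    obtain i where "i < length a" "offset a i \<le> p" "Suc p < offset a (Suc i)"
      using p same_block_iff[of a p] by blast
    then have "(i, 2 * int i - int (Suc p)) \<in> run_cells a" "(i, 2 * int i - int p) \<in> run_cells a"
      unfolding cell_at_position by auto
    moreover have "((i, 2 * int i - int (Suc p)), (i, 2 * int i - int p)) \<in> cell_covers"
      by (simp add: cell_covers_def)
    ultimately have "s ! cell_position (i, 2 * int i - int (Suc p))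
        < s ! cell_position (i, 2 * int i - int p)" using L by blast
    then show ?thesis by (simp only: cell_position_at)
  qed
  moreover have "s ! p < s ! (p + 2)"
    if p: "p + 2 < sum_list a \<and> (Suc p \<in> block_starts a \<or> p + 2 \<in> block_starts a)" for p
  proof -
    obtain i where "Suc i < length a" "offset a i \<le> p" "p < offset a (Suc i)"
      "offset a (Suc i) \<le> p + 2" "p + 2 < offset a (Suc (Suc i))"
      using p next_block_iff[OF a, of p] by blast
    then have "(i, 2 * int i - int p) \<in> run_cells a"
      "(Suc i, 2 * int (Suc i) - int (p + 2)) \<in> run_cells a"
      unfolding cell_at_position by auto
    moreover have "((i, 2 * int i - int p), (Suc i, 2 * int (Suc i) - int (p + 2))) \<in> cell_covers"
      by (simp add: cell_covers_def)
    ultimately have "s ! cell_position (i, 2 * int i - int p)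
        < s ! cell_position (Suc i, 2 * int (Suc i) - int (p + 2))" using L by blast
    then show ?thesis by (simp only: cell_position_at)
  qed
  ultimately show ?R by blast
next
  assume R: ?R
  show ?L
  proof (intro ballI impI)
    fix x y assume xy: "x \<in> run_cells a" "y \<in> run_cells a" "(x, y) \<in> cell_covers"
    obtain i p where x: "x = (i, 2 * int i - int p)" using xy(1) by (cases x) (blast elim: run_cellE)
    obtain j q where y: "y = (j, 2 * int j - int q)" using xy(2) by (cases y) (blast elim: run_cellE)
    have cells: "i < length a" "offset a i \<le> p" "p < offset a (Suc i)"
      "j < length a" "offset a j \<le> q" "q < offset a (Suc j)"
      using xy(1,2) unfolding x y cell_at_position by auto
    consider "j = i" "p = Suc q" | "j = Suc i" "q = p + 2"
      using xy(3) unfolding x y by (auto simp: cell_covers_def)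
    then have "s ! p < s ! q"
    proof cases
      case 1
      then show ?thesis using R cells same_block_iff[of a q] by auto
    next
      case 2
      then have "\<exists>i. Suc i < length a \<and> offset a i \<le> p \<and> p < offset a (Suc i) \<and>
          offset a (Suc i) \<le> p + 2 \<and> p + 2 < offset a (Suc (Suc i))"
        using cells by blast
      then show ?thesis using R 2 next_block_iff[OF a, of p] by blast
    qed
    then show "s ! cell_position x < s ! cell_position y" unfolding x y by (simp only: cell_position_at)
  qed
qed

text \<open>
  That each run starts with an ascent follows from the other conditions: if \<open>q + 1\<close> starts a block
  other than the first, then \<open>q - 1\<close> and \<open>q\<close> lie in one block of length at least 2, so
  \<open>s(q) < s(q - 1) < s(q + 1)\<close>.
\<close>

lemma run_starts_eq_block_starts_iff:
  assumes a: "\<forall>x\<in>set a. 2 \<le> x" and s: "distinct s" "length s = sum_list a"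
    and jump: "\<forall>p. p + 2 < sum_list a \<and> (Suc p \<in> block_starts a \<or> p + 2 \<in> block_starts a) \<longrightarrow>
       s ! p < s ! (p + 2)"
  shows "run_starts s = block_starts a \<longleftrightarrow>
    (\<forall>p. Suc p < sum_list a \<and> Suc p \<notin> block_starts a \<longrightarrow> s ! Suc p < s ! p)"
proof
  assume eq: "run_starts s = block_starts a"
  show "\<forall>p. Suc p < sum_list a \<and> Suc p \<notin> block_starts a \<longrightarrow> s ! Suc p < s ! p"
  proof (intro allI impI)
    fix p assume p: "Suc p < sum_list a \<and> Suc p \<notin> block_starts a"
    then have "\<not> s ! p < s ! Suc p" unfolding eq[symmetric] using s by (auto simp: run_starts_def)
    moreover have "s ! p \<noteq> s ! Suc p" using s p by (simp add: nth_eq_iff_index_eq)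
    ultimately show "s ! Suc p < s ! p" by simp
  qed
next
  assume desc: "\<forall>p. Suc p < sum_list a \<and> Suc p \<notin> block_starts a \<longrightarrow> s ! Suc p < s ! p"
  have lt: "p < sum_list a" if "p \<in> block_starts a" for p
    using block_starts_spaced[OF a that] by simp
  show "run_starts s = block_starts a"
  proof (rule Set.set_eqI)
    fix p show "p \<in> run_starts s \<longleftrightarrow> p \<in> block_starts a"
    proof (cases p)
      case 0
      then show ?thesis
        using s lt[of 0] zero_in_block_starts[of a] by (cases "a = []") (auto simp: run_starts_def)
    next
      case (Suc q)
      show ?thesis
      proof
        assume "p \<in> block_starts a"
        then have p: "Suc q \<in> block_starts a" "Suc q < sum_list a" using Suc lt by auto
        then have "q \<notin> block_starts a" using block_starts_spaced[OF a, of q] by auto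
        moreover have "a \<noteq> []" using p by auto
        ultimately obtain r where r: "q = Suc r" using zero_in_block_starts[of a] by (cases q) auto
        have "s ! r < s ! (r + 2)" using jump p r by simp
        moreover have "s ! q < s ! r" using desc \<open>q \<notin> block_starts a\<close> p r by simp
        ultimately show "p \<in> run_starts s" using p r Suc s by (simp add: run_starts_def)
      next
        assume "p \<in> run_starts s"
        then have "q < sum_list a" "Suc q < sum_list a" "\<not> s ! Suc q < s ! q"
          using s Suc by (auto simp: run_starts_def)
        then show "p \<in> block_starts a" using desc Suc by blast
      qed
    qed
  qed
qed

text \<open>
  Entry \<open>(i, j)\<close> has argument \<open>offset (j + 1) - offset i + i - j\<close>. On and above the diagonal this
  is the argument in the theorem; at distance 1, 2 and at least 3 below the diagonal it is 0,
  \<open>2 - a\<^bsub>j+1\<^esub>\<close> and negative.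
\<close>

lemma inverse_fact_det_eq_det_A_mat:
  assumes a: "\<forall>x\<in>set a. 2 \<le> x"
  shows "inverse_fact_det (length a) (\<lambda>i. row_end a i - int i) (\<lambda>j. row_begin a j - int j) =
    det (A_mat a)"
proof -
  have growth: "offset a i + 2 * m \<le> offset a (i + m)" if "i + m \<le> length a" for i m
    using that
  proof (induction m)
    case (Suc m)
    then have "a ! (i + m) \<ge> 2" using a by simp
    then show ?case using Suc offset_Suc[of "i + m" a] by simp
  qed simp
  have block_sum: "offset a i + (\<Sum>l=i..j. a ! l) = offset a (Suc j)" if "i \<le> j" "j < length a" for i j
    using that
  proof (induction j rule: dec_induct)
    case (step j)
    then show ?case by (simp add: offset_Suc)
  qed (simp add: offset_Suc)
  have entry: "inverse_fact ((row_end a i - int i) - (row_begin a j - int j)) = A_mat a $$ (i, j)"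
    if ij: "i < length a" "j < length a" for i j
  proof -
    have z: "(row_end a i - int i) - (row_begin a j - int j) =
        int i - int j - int (offset a i) + int (offset a (Suc j))"
      by (simp add: row_end_def row_begin_def)
    consider "i \<le> j" | "i = j + 1" | "i = j + 2" | "i \<ge> j + 3" by linarith
    then show ?thesis
    proof cases
      case 1
      have "offset a i + 2 * (Suc j - i) \<le> offset a (Suc j)"
        using growth[of i "Suc j - i"] 1 ij by simp
      moreover have S: "offset a i + (\<Sum>l=i..j. a ! l) = offset a (Suc j)" using block_sum 1 ij by simp
      ultimately have "j \<le> (\<Sum>l=i..j. a ! l) + i" by linarith
      then have "int i - int j - int (offset a i) + int (offset a (Suc j)) =
          int ((\<Sum>l=i..j. a ! l) + i - j)"
        using S by (simp add: of_nat_diff flip: S)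
      then show ?thesis unfolding z using 1 ij by (simp add: A_mat_def inverse_fact_def)
    next
      case 2
      then show ?thesis unfolding z using ij by (simp add: A_mat_def inverse_fact_def)
    next
      case 3
      then have "a ! Suc j \<ge> 2" using a ij by simp
      then show ?thesis unfolding z using 3 ij offset_Suc[of "Suc j" a]
        by (auto simp: A_mat_def inverse_fact_def)
    next
      case 4
      have "offset a (Suc j) + 2 * (i - Suc j) \<le> offset a i" using growth[of "Suc j" "i - Suc j"] 4 ij by simp
      then have "int i - int j - int (offset a i) + int (offset a (Suc j)) < 0" using 4 by linarith
      then show ?thesis unfolding z using 4 ij by (simp add: A_mat_def inverse_fact_def)
    qed
  qed
  have "mat (length a) (length a) (\<lambda>(i, j). inverse_fact ((row_end a i - int i) - (row_begin a j - int j)))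
      = A_mat a" (is "?M = _")
  proof (rule eq_matI)
    fix i j assume "i < dim_row (A_mat a)" "j < dim_col (A_mat a)"
    then have "i < length a" "j < length a" by (simp_all add: A_mat_def)
    then show "?M $$ (i, j) = A_mat a $$ (i, j)" using entry[of i j] by simp
  qed (simp_all add: A_mat_def)
  then show ?thesis by (simp add: inverse_fact_det_def)
qed

lemma card_permutations_with_runs:
  assumes a: "\<forall>x\<in>set a. 2 \<le> x"
  shows "real (card {s \<in> permutations_of_set {1..sum_list a}. run_starts s = block_starts a \<and>
      (\<forall>p. p + 2 < sum_list a \<and> (Suc p \<in> block_starts a \<or> p + 2 \<in> block_starts a) \<longrightarrow>
         s ! p < s ! (p + 2))}) = fact (sum_list a) * det (A_mat a)"
    (is "real (card ?S) = _")
proof -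
  have "?S = {s \<in> permutations_of_set {1..sum_list a}.
      \<forall>x\<in>run_cells a. \<forall>y\<in>run_cells a. (x, y) \<in> cell_covers \<longrightarrow>
        s ! cell_position x < s ! cell_position y}"
  proof (rule Collect_cong, rule conj_cong, rule refl)
    fix s assume s: "s \<in> permutations_of_set {1..sum_list a}"
    then have "distinct s" "length s = sum_list a"
      using length_finite_permutations_of_set[OF s] by (auto simp: permutations_of_set_def)
    then show "run_starts s = block_starts a \<and>
      (\<forall>p. p + 2 < sum_list a \<and> (Suc p \<in> block_starts a \<or> p + 2 \<in> block_starts a) \<longrightarrow>
         s ! p < s ! (p + 2)) \<longleftrightarrow> (\<forall>x\<in>run_cells a. \<forall>y\<in>run_cells a. (x, y) \<in> cell_covers \<longrightarrow>
        s ! cell_position x < s ! cell_position y)"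
      unfolding covers_increasing_iff[OF a] using run_starts_eq_block_starts_iff[OF a] by blast
  qed
  then have "card ?S = card (linear_extensions (run_cells a) cell_covers)"
    using card_linear_extensions_permutations[OF bij_betw_cell_position] by simp
  moreover have "card (run_cells a) = sum_list a"
    using bij_betw_same_card[OF bij_betw_cell_position] by simp
  moreover have "real (card (linear_extensions (run_cells a) cell_covers)) =
      fact (card (run_cells a)) * inverse_fact_det (length a)
        (\<lambda>i. row_end a i - int i) (\<lambda>j. row_begin a j - int j)"
  proof (rule card_skew_tableaux)
    fix i
    have step: "offset a i + 2 \<le> offset a (Suc i)" if "i < length a" for i
      using a that offset_Suc[of i a] by simp
    show "i < length a \<Longrightarrow> row_begin a i \<le> row_end a i"
      using step[of i] by (simp add: row_begin_def row_end_def)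
    show "Suc i < length a \<Longrightarrow> row_begin a (Suc i) \<le> row_begin a i"
      using step[of "Suc i"] by (simp add: row_begin_def)
    show "Suc i < length a \<Longrightarrow> row_end a (Suc i) \<le> row_end a i"
      using step[of i] by (simp add: row_end_def)
  qed
  ultimately show ?thesis by (simp add: inverse_fact_det_eq_det_A_mat[OF a])
qed

lemma minimal_perm_iff_ex_composition:
  assumes s: "s \<in> permutations_of_set {1..d + k}"
  shows "minimal_perm d s \<longleftrightarrow>
    (\<exists>a. length a = k \<and> (\<forall>x\<in>set a. 2 \<le> x) \<and> sum_list a = d + k \<and> run_starts s = block_starts a \<and>
      (\<forall>p. p + 2 < sum_list a \<and> (Suc p \<in> block_starts a \<or> p + 2 \<in> block_starts a) \<longrightarrow>
         s ! p < s ! (p + 2)))"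
proof -
  have len: "length s = d + k" using length_finite_permutations_of_set[OF s] by simp
  have perm: "is_perm s" and dist: "distinct s"
    using s len by (auto simp: is_perm_def permutations_of_set_def)
  note count = descents_plus_run_starts[OF dist]
  obtain a where a: "\<forall>x\<in>set a. 1 \<le> x" "sum_list a = length s" "block_starts a = run_starts s"
    using ex_composition_run_starts by blast
  show ?thesis
  proof
    assume min: "minimal_perm d s"
    then have "descents s = d" by (simp add: minimal_perm_def)
    then have "length a = k" using count len card_block_starts[OF a(1)] a(3) by simp
    moreover have "\<forall>x\<in>set a. 2 \<le> x"
      using min unfolding minimal_perm_iff_run_starts[OF perm]
      by (intro spaced_block_starts[OF a(1)]) (simp add: a(2,3))
    ultimately show "\<exists>a. length a = k \<and> (\<forall>x\<in>set a. 2 \<le> x) \<and> sum_list a = d + k \<and>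
      run_starts s = block_starts a \<and>
      (\<forall>p. p + 2 < sum_list a \<and> (Suc p \<in> block_starts a \<or> p + 2 \<in> block_starts a) \<longrightarrow>
         s ! p < s ! (p + 2))"
      using min len a(2,3) unfolding minimal_perm_iff_run_starts[OF perm]
      by (intro exI[of _ a]) simp
  next
    assume "\<exists>a. length a = k \<and> (\<forall>x\<in>set a. 2 \<le> x) \<and> sum_list a = d + k \<and>
      run_starts s = block_starts a \<and>
      (\<forall>p. p + 2 < sum_list a \<and> (Suc p \<in> block_starts a \<or> p + 2 \<in> block_starts a) \<longrightarrow>
         s ! p < s ! (p + 2))"
    then obtain b where b: "length b = k" "\<forall>x\<in>set b. 2 \<le> x" "sum_list b = d + k"
      "run_starts s = block_starts b"
      "\<forall>p. p + 2 < sum_list b \<and> (Suc p \<in> block_starts b \<or> p + 2 \<in> block_starts b) \<longrightarrow>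
         s ! p < s ! (p + 2)" by blast
    have "card (block_starts b) = k" using card_block_starts[of b] b(1,2) by force
    then have "descents s = d" using count len b(4) by simp
    moreover have "\<forall>p\<in>block_starts b. Suc p \<notin> block_starts b \<and> p + 2 \<le> sum_list b"
      using block_starts_spaced[OF b(2)] by blast
    ultimately show "minimal_perm d s"
      using b(3,5) len unfolding minimal_perm_iff_run_starts[OF perm] b(4) by simp
  qed
qed

theorem theorem4p2:
  fixes d k :: nat
  assumes "1 \<le> k" and "k \<le> d"
  shows "real (num_minimal (d + k) d) =
    (\<Sum>a \<in> {a :: nat list. length a = k \<and> (\<forall>x \<in> set a. 2 \<le> x) \<and> sum_list a = d + k}.
       fact (d + k) * det (A_mat a))"
proof -
  let ?A = "{a :: nat list. length a = k \<and> (\<forall>x \<in> set a. 2 \<le> x) \<and> sum_list a = d + k}"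
  let ?S = "\<lambda>a. {s \<in> permutations_of_set {1..sum_list a}. run_starts s = block_starts a \<and>
      (\<forall>p. p + 2 < sum_list a \<and> (Suc p \<in> block_starts a \<or> p + 2 \<in> block_starts a) \<longrightarrow>
         s ! p < s ! (p + 2))}"
  have "finite ?A"
    by (rule finite_subset[OF _ finite_lists_length_eq[of "{..d + k}" k]])
       (auto dest: member_le_sum_list)
  moreover have "\<forall>a\<in>?A. finite (?S a)" by simp
  moreover have "\<forall>a\<in>?A. \<forall>b\<in>?A. a \<noteq> b \<longrightarrow> ?S a \<inter> ?S b = {}"
  proof (intro ballI impI)
    fix a b assume ab: "a \<in> ?A" "b \<in> ?A" "a \<noteq> b"
    then have "block_starts a \<noteq> block_starts b" using block_starts_inject[of a b] by force
    then show "?S a \<inter> ?S b = {}" by auto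
  qed
  ultimately have "card (\<Union>a\<in>?A. ?S a) = (\<Sum>a\<in>?A. card (?S a))" by (rule card_UN_disjoint)
  moreover have "{s \<in> permutations_of_set {1..d + k}. minimal_perm d s} = (\<Union>a\<in>?A. ?S a)"
    (is "?M = _")
  proof (rule Set.set_eqI)
    fix s
    have "s \<in> ?M \<longleftrightarrow> s \<in> permutations_of_set {1..d + k} \<and> (\<exists>a. length a = k \<and>
      (\<forall>x\<in>set a. 2 \<le> x) \<and> sum_list a = d + k \<and> run_starts s = block_starts a \<and>
      (\<forall>p. p + 2 < sum_list a \<and> (Suc p \<in> block_starts a \<or> p + 2 \<in> block_starts a) \<longrightarrow>
         s ! p < s ! (p + 2)))"
      unfolding mem_Collect_eq by (rule conj_cong[OF refl minimal_perm_iff_ex_composition])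
    also have "\<dots> \<longleftrightarrow> s \<in> (\<Union>a\<in>?A. ?S a)" by auto
    finally show "s \<in> ?M \<longleftrightarrow> s \<in> (\<Union>a\<in>?A. ?S a)" .
  qed
  ultimately have "real (num_minimal (d + k) d) = (\<Sum>a\<in>?A. real (card (?S a)))"
    by (simp add: num_minimal_def)
  also have "\<dots> = (\<Sum>a\<in>?A. fact (d + k) * det (A_mat a))"
  proof (rule sum.cong[OF refl])
    fix a assume "a \<in> ?A"
    then have "\<forall>x\<in>set a. 2 \<le> x" "sum_list a = d + k" by auto
    then show "real (card (?S a)) = fact (d + k) * det (A_mat a)"
      using card_permutations_with_runs[of a] by simp
  qed
  finally show ?thesis .
qed

end
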